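(* Let $\beta>0$ and let $g$ be a function on $(0,\beta]$ which is integrable on $[\delta,\beta]$ for every $0<\delta<\beta$. If $w_1$ and $w_2$ are initialization functions such that both limits $$L_i=\lim_{\delta\to 0^+}\left\{\int_0^\delta g(u)\,w_i(u/\delta)\,du+\int_\delta^\beta g(u)\,du\right\},\qquad i=1,2,$$ exist, then $L_1=L_2$. That is, the generalized improper integral $Z\!\!\int_0^\beta g(u)\,du$ has the same value for all initialization functions for which the limit exists.
   Context: Initialization function: a finite real-valued function $w$ on $\mathbb{R}$ for which there is $\epsilon$ with $0<\epsilon\le 1$ such that $w(v)=0$ for $v<\epsilon$, $w(v)=1$ for $v\ge 1$, and $w'(v)\ge 0$ (i.e. $w$ is nondecreasing; $w'$ need not exist classically everywhere). Different initialization functions may have different $\epsilon$. Generalized improper integral (critical lower limit $0$, noncritical upper limit $\beta$): for an initialization function $w$ (not depending on $\delta$), $$Z\!\!\int_{0}^{\beta} g(u)\,du = \lim_{\delta\to 0^+}\left\{\int_0^\delta g(u)\,w(u/\delta)\,du+\int_\delta^\beta g(u)\,du\right\},$$ where the integrals inside the limit are conventional ones (since $w(u/\delta)=0$ for $u<\epsilon\delta$, the first is effectively over $[\epsilon\delta,\delta]$), and existence of a limit means existence as a finite number. *)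

theory Defs
  imports "HOL-Analysis.Analysis"
begin

definition initialization_function :: "(real \<Rightarrow> real) \<Rightarrow> bool" where
  "initialization_function w \<longleftrightarrow>
     mono w \<and> (\<exists>\<epsilon>. 0 < \<epsilon> \<and> \<epsilon> \<le> 1 \<and> (\<forall>v<\<epsilon>. w v = 0) \<and> (\<forall>v\<ge>1. w v = 1))"

(* "Conventional" integrals are Henstock-Kurzweil integrals, which extend the proper Riemann
   and the Lebesgue integral, so the hypothesis that g is integrable is as weak as possible.
   The integrand over [0, \<delta>] vanishes near 0, so the value of g at 0 is irrelevant; as w is
   monotone, the product is integrable as soon as g is integrable away from 0. *)
definition initialized_integral ::
    "(real \<Rightarrow> real) \<Rightarrow> (real \<Rightarrow> 'a::euclidean_space) \<Rightarrow> real \<Rightarrow> real \<Rightarrow> 'a" where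
  "initialized_integral w g \<beta> \<delta> =
     integral {0..\<delta>} (\<lambda>u. w (u / \<delta>) *\<^sub>R g u) + integral {\<delta>..\<beta>} g"

definition has_Z_integral ::
    "(real \<Rightarrow> real) \<Rightarrow> (real \<Rightarrow> 'a::euclidean_space) \<Rightarrow> real \<Rightarrow> 'a \<Rightarrow> bool" where
  "has_Z_integral w g \<beta> L \<longleftrightarrow> (initialized_integral w g \<beta> \<longlongrightarrow> L) (at_right 0)"

end

theory Submission
  imports Defs
begin

text \<open>Put \<open>H x = \<integral>\<^sub>x\<^sup>\<beta> g\<close>. Integration by parts turns the initialized integral at \<open>\<delta>\<close> into
  the average \<open>F\<^sub>w \<delta> = \<integral> H (\<delta> v) dw(v)\<close> of \<open>H\<close> against the probability distribution with
  distribution function \<open>w\<close>, whose support lies in \<open>[\<epsilon>, 1]\<close>. The double average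
  \<open>\<integral>\<integral> H (\<delta> v v') dw\<^sub>1(v) dw\<^sub>2(v')\<close> is at the same time an average of values \<open>F\<^bsub>w\<^sub>1\<^esub> (\<delta> v')\<close>
  and an average of values \<open>F\<^bsub>w\<^sub>2\<^esub> (\<delta> v)\<close>, so for small \<open>\<delta>\<close> it is close to both limits.
  The second mean value theorem gives the averages as finite sums over a grid, with
  intermediate points as the only error, so no Stieltjes integral is needed.\<close>

text \<open>Discrete integration by parts: the second mean value theorem is applied once per cell,
  every integral is written as a difference of values of the tail integral up to \<open>b\<close>,
  and the boundary terms at interior grid points telescope. The intermediate points
  \<open>c i\<close> depend on \<open>w\<close>.\<close>

lemma second_mean_value_theorem_sum:
  fixes f w :: "real \<Rightarrow> real" and x :: "nat \<Rightarrow> real"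
  assumes f: "f integrable_on {x 0..b}" and w: "mono w" and x: "mono x" and "x n \<le> b"
  shows "\<exists>c. (\<forall>i<n. c i \<in> {x i..x (Suc i)}) \<and>
    ((\<lambda>u. w u * f u) has_integral
      (w (x 0) * integral {x 0..b} f - w (x n) * integral {x n..b} f
        + (\<Sum>i<n. (w (x (Suc i)) - w (x i)) * integral {c i..b} f))) {x 0..x n}"
  using \<open>x n \<le> b\<close>
proof (induction n)
  case 0
  then show ?case using has_integral_refl(2)[of _ "x 0"] by simp
next
  case (Suc n)
  define H where "H = (\<lambda>t. integral {t..b} f)"
  have le: "x 0 \<le> x n" "x n \<le> x (Suc n)"
    by (auto intro: monoD[OF x])
  obtain c where c: "\<forall>i<n. c i \<in> {x i..x (Suc i)}"
    and int1: "((\<lambda>u. w u * f u) has_integral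
      (w (x 0) * H (x 0) - w (x n) * H (x n)
        + (\<Sum>i<n. (w (x (Suc i)) - w (x i)) * H (c i)))) {x 0..x n}"
    using Suc le unfolding H_def by force
  have "f integrable_on {x n..x (Suc n)}"
    by (rule integrable_subinterval_real[OF f]) (use le Suc in auto)
  then obtain d where d: "d \<in> {x n..x (Suc n)}"
    and int2: "((\<lambda>u. w u * f u) has_integral
      (w (x n) * integral {x n..d} f + w (x (Suc n)) * integral {d..x (Suc n)} f))
      {x n..x (Suc n)}"
    using second_mean_value_theorem_full[of f "x n" "x (Suc n)" w, OF _ le(2) monoD[OF w]]
    by blast
  have split: "integral {s..t} f = H s - H t" if "x 0 \<le> s" "s \<le> t" "t \<le> b" for s t
  proof -
    have "f integrable_on {s..b}"
      by (rule integrable_subinterval_real[OF f]) (use that in auto)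
    from Henstock_Kurzweil_Integration.integral_combine[OF that(2,3) this] show ?thesis
      unfolding H_def by simp
  qed
  have eq: "w (x n) * integral {x n..d} f + w (x (Suc n)) * integral {d..x (Suc n)} f
      = w (x n) * H (x n) - w (x (Suc n)) * H (x (Suc n)) + (w (x (Suc n)) - w (x n)) * H d"
    using d le Suc.prems by (simp add: split algebra_simps)
  have int: "((\<lambda>u. w u * f u) has_integral
      (w (x 0) * H (x 0) - w (x (Suc n)) * H (x (Suc n))
        + (\<Sum>i<Suc n. (w (x (Suc i)) - w (x i)) * H ((c(n := d)) i)))) {x 0..x (Suc n)}"
    using has_integral_combine[OF le int1 int2[unfolded eq]] by (simp add: algebra_simps)
  have "\<forall>i<Suc n. (c(n := d)) i \<in> {x i..x (Suc i)}"
    using c d by (auto simp: less_Suc_eq)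
  with int show ?case
    unfolding H_def by blast
qed

text \<open>The previous sum is applied to the grid scaled by \<delta>. Its lower boundary term
  vanishes because \<open>w\<close> is zero at \<open>v 0\<close>, and its upper one is the integral
  over \<open>{\<delta>..\<beta>}\<close>, exactly what \<open>initialized_integral\<close> adds
  back. Below \<open>\<delta> * v 0\<close> the integrand is zero.\<close>

lemma initialized_integrand_has_integral:
  fixes f w :: "real \<Rightarrow> real" and v :: "nat \<Rightarrow> real"
  assumes w: "mono w" "\<And>t. t \<le> v 0 \<Longrightarrow> w t = 0" "w (v n) = 1"
    and v: "mono v" "0 < v 0" "v n = 1"
    and \<delta>: "0 < \<delta>" "\<delta> \<le> \<beta>" and f: "f integrable_on {\<delta> * v 0..\<beta>}"
  shows "\<exists>c. (\<forall>i<n. c i \<in> {v i..v (Suc i)}) \<and>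
    ((\<lambda>u. w (u / \<delta>) * f u) has_integral
      ((\<Sum>i<n. (w (v (Suc i)) - w (v i)) * integral {\<delta> * c i..\<beta>} f) - integral {\<delta>..\<beta>} f))
      {0..\<delta>}"
proof -
  have "mono (\<lambda>u. w (u / \<delta>))" "mono (\<lambda>i. \<delta> * v i)"
    using \<delta>(1) by (auto intro!: monoI monoD[OF w(1)] monoD[OF v(1)] divide_right_mono)
  from second_mean_value_theorem_sum[OF f this(1) this(2), of n]
  obtain c where c: "\<forall>i<n. c i \<in> {\<delta> * v i..\<delta> * v (Suc i)}"
    and int: "((\<lambda>u. w (u / \<delta>) * f u) has_integral
      ((\<Sum>i<n. (w (v (Suc i)) - w (v i)) * integral {c i..\<beta>} f) - integral {\<delta>..\<beta>} f))
      {\<delta> * v 0..\<delta>}"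
    using w(2)[of "v 0"] w(3) v \<delta> by auto
  have "((\<lambda>u. w (u / \<delta>) * f u) has_integral 0) {0..\<delta> * v 0}"
    using w(2) \<delta> by (intro has_integral_is_0) (auto simp: field_simps)
  moreover have "v 0 \<le> 1"
    using monoD[OF v(1), of 0 n] v(3) by simp
  ultimately have "((\<lambda>u. w (u / \<delta>) * f u) has_integral
      ((\<Sum>i<n. (w (v (Suc i)) - w (v i)) * integral {c i..\<beta>} f) - integral {\<delta>..\<beta>} f))
      {0..\<delta>}"
    using has_integral_combine[OF _ _ _ int, of 0 0] v \<delta> by simp
  moreover have "\<forall>i<n. c i / \<delta> \<in> {v i..v (Suc i)}"
    using c \<delta> by (auto simp: field_simps)
  ultimately show ?thesis
    using \<delta> by (intro exI[of _ "\<lambda>i. c i / \<delta>"]) simp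
qed

lemma sum_weighted_close:
  fixes q a :: "'i \<Rightarrow> real"
  assumes "\<And>i. i \<in> A \<Longrightarrow> 0 \<le> q i" "sum q A = 1" "\<And>i. i \<in> A \<Longrightarrow> \<bar>a i - l\<bar> \<le> e"
  shows "\<bar>(\<Sum>i\<in>A. q i * a i) - l\<bar> \<le> e"
proof -
  have "(\<Sum>i\<in>A. q i * a i) - l = (\<Sum>i\<in>A. q i * (a i - l))"
    using assms(2) by (simp add: right_diff_distrib sum_subtractf flip: sum_distrib_right)
  also have "\<bar>\<dots>\<bar> \<le> (\<Sum>i\<in>A. q i * e)"
    using assms(1,3) by (intro order_trans[OF sum_abs] sum_mono)
      (auto simp: abs_mult intro: mult_left_mono)
  also have "\<dots> = e"
    using assms(2) by (simp flip: sum_distrib_right)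
  finally show ?thesis .
qed

lemma has_Z_integral_near:
  assumes "has_Z_integral w f \<beta> L" "\<eta> > 0"
  obtains r where "r > 0" "\<And>d. 0 < d \<Longrightarrow> d < r \<Longrightarrow> norm (initialized_integral w f \<beta> d - L) < \<eta>"
proof -
  have "\<forall>\<^sub>F d in at_right 0. norm (initialized_integral w f \<beta> d - L) < \<eta>"
    using assms unfolding has_Z_integral_def by (auto dest!: tendstoD simp: dist_norm)
  then show thesis
    using that unfolding eventually_at_right_field by auto
qed

text \<open>Exchanging the two averages requires the same values of \<open>H\<close> in both orders,
  hence one grid \<open>v\<close> for both functions and all scales. The intermediate points vary
  with function and scale; uniform continuity of \<open>H\<close> moves them to the grid.\<close>

lemma has_Z_integral_unique_real:
  fixes f w1 w2 :: "real \<Rightarrow> real"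
  assumes "\<beta> > 0" and f: "\<And>\<delta>. 0 < \<delta> \<Longrightarrow> \<delta> < \<beta> \<Longrightarrow> f integrable_on {\<delta>..\<beta>}"
    and w1: "initialization_function w1" and w2: "initialization_function w2"
    and L1: "has_Z_integral w1 f \<beta> L1" and L2: "has_Z_integral w2 f \<beta> L2"
  shows "L1 = L2"
proof -
  define H where "H = (\<lambda>t. integral {t..\<beta>} f)"
  obtain e1 e2 where e12: "0 < e1" "e1 \<le> 1" "\<forall>v<e1. w1 v = 0" "0 < e2" "e2 \<le> 1" "\<forall>v<e2. w2 v = 0"
    using w1 w2 unfolding initialization_function_def by blast
  \<comment> \<open>Halving makes both functions vanish at \<open>e\<close> itself, not only below
    it, and gives \<open>e < 1\<close>.\<close>
  define e where "e = min e1 e2 / 2"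
  have e: "0 < e" "e < 1" "\<And>t. t \<le> e \<Longrightarrow> w1 t = 0" "\<And>t. t \<le> e \<Longrightarrow> w2 t = 0"
    using e12 unfolding e_def by auto
  have mono: "mono w1" "mono w2" and one: "w1 1 = 1" "w2 1 = 1"
    using w1 w2 unfolding initialization_function_def by auto
  have close: "\<bar>L1 - L2\<bar> \<le> \<eta>" if "\<eta> > 0" for \<eta>
  proof -
    \<comment> \<open>The double sum \<open>S\<close> will be within \<open>2 * \<zeta>\<close> of
      each limit.\<close>
    define \<zeta> where "\<zeta> = \<eta> / 4"
    have \<zeta>: "\<zeta> > 0" using that by (simp add: \<zeta>_def)
    obtain r1 where r1: "r1 > 0" "\<And>d. 0 < d \<Longrightarrow> d < r1 \<Longrightarrow> norm (initialized_integral w1 f \<beta> d - L1) < \<zeta>"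
      using has_Z_integral_near[OF L1 \<zeta>] by blast
    obtain r2 where r2: "r2 > 0" "\<And>d. 0 < d \<Longrightarrow> d < r2 \<Longrightarrow> norm (initialized_integral w2 f \<beta> d - L2) < \<zeta>"
      using has_Z_integral_near[OF L2 \<zeta>] by blast
    define \<delta> where "\<delta> = min \<beta> (min r1 r2) / 2"
    have \<delta>: "0 < \<delta>" "\<delta> < \<beta>" "\<delta> < r1" "\<delta> < r2"
      using \<open>\<beta> > 0\<close> r1(1) r2(1) unfolding \<delta>_def by auto
    \<comment> \<open>The least argument at which \<open>H\<close> is evaluated: a scale of at least
      \<open>\<delta> * e\<close> times a grid point of at least \<open>e\<close>.\<close>
    define A where "A = \<delta> * e * e"
    have "e * e < 1" using e by (metis mult_strict_mono' less_imp_le mult_1)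
    then have "\<delta> * (e * e) < \<delta> * 1"
      using \<delta>(1) by (intro mult_strict_left_mono)
    then have A: "0 < A" "A < \<delta>" using e \<delta> by (auto simp: A_def mult.assoc)
    have "continuous_on {A..\<beta>} H"
      unfolding H_def using f[of A] A \<delta> by (intro indefinite_integral_continuous_1') auto
    then have "uniformly_continuous_on {A..\<beta>} H"
      by (intro compact_uniformly_continuous) auto
    then obtain \<rho> where \<rho>: "\<rho> > 0"
      "\<And>s t. s \<in> {A..\<beta>} \<Longrightarrow> t \<in> {A..\<beta>} \<Longrightarrow> \<bar>s - t\<bar> < \<rho> \<Longrightarrow> \<bar>H s - H t\<bar> < \<zeta>"
      using \<zeta> unfolding uniformly_continuous_on_def dist_real_def by metis
    \<comment> \<open>Scaling by at most \<delta> leaves cells of length at most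
      \<open>\<delta> / n\<close>, below the modulus \<rho>.\<close>
    obtain n :: nat where n: "n > 0" "\<delta> / n < \<rho>"
    proof -
      obtain n :: nat where "\<delta> / \<rho> < n" using reals_Archimedean2 by blast
      moreover from this have "n > 0" using \<delta> \<rho> by (cases n) (auto simp: field_simps)
      ultimately show thesis using that[of n] \<rho> by (simp add: field_simps)
    qed
    define v where "v = (\<lambda>i. e + real i * ((1 - e) / n))"
    have v: "mono v" "v 0 = e" "v n = 1"
      using e n by (auto simp: v_def intro!: monoI mult_right_mono divide_right_mono)
    have v_bounds: "e \<le> v i" "v i \<le> 1" if "i \<le> n" for i
      using monoD[OF v(1), of 0 i] monoD[OF v(1), of i n] that v by auto
    have step: "v (Suc i) - v i \<le> 1 / n" for i
      using e n by (simp add: v_def field_simps)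
    \<comment> \<open>One \<zeta> pays for replacing \<open>c i\<close> by \<open>v i\<close>, the
      other for the distance of the initialized integral from its limit.\<close>
    have average: "\<bar>(\<Sum>i<n. (w (v (Suc i)) - w (v i)) * H (d * v i)) - L\<bar> \<le> 2 * \<zeta>"
      if w: "mono w" "\<And>t. t \<le> e \<Longrightarrow> w t = 0" "w 1 = 1"
        and near: "norm (initialized_integral w f \<beta> d - L) < \<zeta>"
        and d: "\<delta> * e \<le> d" "d \<le> \<delta>" for w d L
    proof -
      have d0: "0 < d" "d \<le> \<beta>" using d e \<delta> by (auto intro: less_le_trans[OF mult_pos_pos])
      have Ade: "A \<le> d * e" using d e unfolding A_def by (intro mult_right_mono) auto
      have "f integrable_on {d * v 0..\<beta>}"
        by (rule integrable_subinterval_real[OF f[of A]]) (use A \<delta> Ade v in auto)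
      from initialized_integrand_has_integral[OF w(1) _ _ v(1) _ v(3) d0 this] w v e
      obtain c where c: "\<forall>i<n. c i \<in> {v i..v (Suc i)}"
        and int: "((\<lambda>u. w (u / d) * f u) has_integral
          ((\<Sum>i<n. (w (v (Suc i)) - w (v i)) * H (d * c i)) - H d)) {0..d}"
        unfolding H_def by auto
      have F: "initialized_integral w f \<beta> d = (\<Sum>i<n. (w (v (Suc i)) - w (v i)) * H (d * c i))"
        using int unfolding initialized_integral_def H_def by (simp add: integral_unique)
      have "\<bar>(\<Sum>i<n. (w (v (Suc i)) - w (v i)) * (H (d * v i) - H (d * c i))) - 0\<bar> \<le> \<zeta>"
      proof (rule sum_weighted_close)
        show "0 \<le> w (v (Suc i)) - w (v i)" for i
          using monoD[OF w(1) monoD[OF v(1), of i "Suc i"]] by simp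
        show "(\<Sum>i<n. w (v (Suc i)) - w (v i)) = 1"
          using w v by (simp add: sum_lessThan_telescope[of "\<lambda>i. w (v i)"])
      next
        fix i assume "i \<in> {..<n}"
        then have ci: "v i \<le> c i" "c i \<le> v (Suc i)" and vi: "e \<le> v i" "v i \<le> 1" "v (Suc i) \<le> 1"
          using c v_bounds[of i] v_bounds[of "Suc i"] by auto
        have "d * (c i - v i) \<le> \<delta> * (1 / n)"
          using d0 d \<delta> ci step[of i] by (intro mult_mono) auto
        moreover have "d * v i \<le> d * c i"
          using ci d0 by (intro mult_left_mono) auto
        ultimately have "\<bar>d * v i - d * c i\<bar> < \<rho>"
          using n(2) by (simp add: right_diff_distrib)
        moreover have "d * t \<in> {A..\<beta>}" if "e \<le> t" "t \<le> 1" for t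
        proof -
          have "d * e \<le> d * t" "d * t \<le> d * 1" using that d0 by (auto intro: mult_left_mono)
          then have "A \<le> d * t" "d * t \<le> \<beta>" using Ade d0 by linarith+
          then show ?thesis by simp
        qed
        ultimately show "\<bar>H (d * v i) - H (d * c i) - 0\<bar> \<le> \<zeta>"
          using \<rho>(2)[of "d * v i" "d * c i"] ci vi by auto
      qed
      then show ?thesis
        using near unfolding F by (simp add: right_diff_distrib sum_subtractf)
    qed
    \<comment> \<open>Each scale \<open>\<delta> * v j\<close> is admissible in
      \<open>average\<close>, and a convex combination of the inner sums keeps their error
      bound.\<close>
    have double: "\<bar>(\<Sum>j<n. (w' (v (Suc j)) - w' (v j)) *
        (\<Sum>i<n. (w (v (Suc i)) - w (v i)) * H (\<delta> * v j * v i))) - L\<bar> \<le> 2 * \<zeta>"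
      if w: "mono w" "\<And>t. t \<le> e \<Longrightarrow> w t = 0" "w 1 = 1"
        and w': "mono w'" "\<And>t. t \<le> e \<Longrightarrow> w' t = 0" "w' 1 = 1"
        and near: "\<And>d. 0 < d \<Longrightarrow> d \<le> \<delta> \<Longrightarrow> norm (initialized_integral w f \<beta> d - L) < \<zeta>"
      for w w' L
    proof (rule sum_weighted_close)
      show "0 \<le> w' (v (Suc j)) - w' (v j)" for j
        using monoD[OF w'(1) monoD[OF v(1), of j "Suc j"]] by simp
      show "(\<Sum>j<n. w' (v (Suc j)) - w' (v j)) = 1"
        using w' v by (simp add: sum_lessThan_telescope[of "\<lambda>i. w' (v i)"])
    next
      fix j assume "j \<in> {..<n}"
      then have "e \<le> v j" "v j \<le> 1" using v_bounds[of j] by auto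
      then have "\<delta> * e \<le> \<delta> * v j" "\<delta> * v j \<le> \<delta>" "0 < \<delta> * v j"
        using \<delta> e by (auto intro: mult_left_mono)
      then show "\<bar>(\<Sum>i<n. (w (v (Suc i)) - w (v i)) * H (\<delta> * v j * v i)) - L\<bar> \<le> 2 * \<zeta>"
        by (intro average[OF w] near)
    qed
    define S where "S = (\<Sum>j<n. (w2 (v (Suc j)) - w2 (v j)) *
        (\<Sum>i<n. (w1 (v (Suc i)) - w1 (v i)) * H (\<delta> * v j * v i)))"
    \<comment> \<open>The argument \<open>\<delta> * v j * v i\<close> is symmetric in
      \<open>i\<close> and \<open>j\<close>, so swapping the sums exchanges the roles of
      \<open>w1\<close> and \<open>w2\<close>.\<close>
    have "S = (\<Sum>j<n. (w1 (v (Suc j)) - w1 (v j)) *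
        (\<Sum>i<n. (w2 (v (Suc i)) - w2 (v i)) * H (\<delta> * v j * v i)))"
      unfolding S_def sum_distrib_left by (subst sum.swap) (simp add: mult_ac)
    then have "\<bar>S - L2\<bar> \<le> 2 * \<zeta>"
      using double[of w2 w1 L2] e mono one r2(2) \<delta> by simp
    moreover have "\<bar>S - L1\<bar> \<le> 2 * \<zeta>"
      unfolding S_def using double[of w1 w2 L1] e mono one r1(2) \<delta> by simp
    ultimately show ?thesis unfolding \<zeta>_def by linarith
  qed
  show ?thesis
    using close[of "\<bar>L1 - L2\<bar> / 2"] by (cases "L1 = L2") auto
qed

text \<open>Reduces the vector-valued case to real components. Passing the inner product through the
  integral needs integrability of the weighted integrand on \<open>{0..d}\<close>, which is obtained
  componentwise from the mean value lemma.\<close>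

lemma has_Z_integral_inner:
  fixes g :: "real \<Rightarrow> 'a::euclidean_space"
  assumes "\<beta> > 0" and g: "\<And>\<delta>. 0 < \<delta> \<Longrightarrow> \<delta> < \<beta> \<Longrightarrow> g integrable_on {\<delta>..\<beta>}"
    and w: "initialization_function w" and L: "has_Z_integral w g \<beta> L"
  shows "has_Z_integral w (\<lambda>u. g u \<bullet> b) \<beta> (L \<bullet> b)"
proof -
  obtain \<epsilon> where \<epsilon>: "0 < \<epsilon>" "\<epsilon> \<le> 1" "\<forall>v<\<epsilon>. w v = 0" and "mono w" "w 1 = 1"
    using w unfolding initialization_function_def by auto
  \<comment> \<open>A grid with a single cell suffices, since only integrability is wanted; it
    starts at \<open>\<epsilon> / 2\<close> because \<open>w\<close> must vanish at its left
    end.\<close>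
  define v where "v = (\<lambda>i::nat. if i = 0 then \<epsilon> / 2 else 1)"
  have "mono v" using \<epsilon> by (auto simp: v_def intro!: monoI)
  have comp: "initialized_integral w g \<beta> d \<bullet> b = initialized_integral w (\<lambda>u. g u \<bullet> b) \<beta> d"
    if d: "0 < d" "d < \<beta>" for d
  proof -
    have v0: "0 < v 0" "v 0 < 1"
      using \<epsilon> by (auto simp: v_def)
    have "d * v 0 < \<beta>"
      using mult_strict_left_mono[OF v0(2) d(1)] d(2) by linarith
    then have "g integrable_on {d * v 0..\<beta>}"
      using d(1) v0(1) by (intro g) auto
    then have "(\<lambda>u. g u \<bullet> k) integrable_on {d * v 0..\<beta>}" for k
      by (auto dest: integrable_linear[OF _ bounded_linear_inner_left] simp: o_def)
    then have "(\<lambda>u. w (u / d) * (g u \<bullet> k)) integrable_on {0..d}" for k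
      using initialized_integrand_has_integral[of w v 1 d \<beta> "\<lambda>u. g u \<bullet> k"]
        \<open>mono w\<close> \<open>mono v\<close> \<open>w 1 = 1\<close> \<epsilon> d by (auto simp: v_def)
    then have "(\<lambda>u. w (u / d) *\<^sub>R g u) integrable_on {0..d}"
      by (subst integrable_componentwise_iff) simp
    then show ?thesis
      using g[OF d] unfolding initialized_integral_def
      by (simp add: inner_add_left flip: integral_component_eq)
  qed
  have "((\<lambda>d. initialized_integral w g \<beta> d \<bullet> b) \<longlongrightarrow> L \<bullet> b) (at_right 0)"
    using L unfolding has_Z_integral_def by (intro tendsto_intros)
  then show ?thesis
    unfolding has_Z_integral_def
    by (rule Lim_transform_eventually)
      (use comp \<open>\<beta> > 0\<close> in \<open>auto simp: eventually_at_right_field\<close>)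
qed

theorem mainTheorem2:
  fixes g :: "real \<Rightarrow> 'a::euclidean_space"
    and w1 w2 :: "real \<Rightarrow> real"
    and \<beta> :: real
    and L1 L2 :: 'a
  assumes "\<beta> > 0"
    and "\<And>\<delta>. 0 < \<delta> \<Longrightarrow> \<delta> < \<beta> \<Longrightarrow> g integrable_on {\<delta>..\<beta>}"
    and "initialization_function w1"
    and "initialization_function w2"
    and "has_Z_integral w1 g \<beta> L1"
    and "has_Z_integral w2 g \<beta> L2"
  shows "L1 = L2"
proof (rule euclidean_eqI)
  fix b :: 'a
  have "(\<lambda>u. g u \<bullet> b) integrable_on {\<delta>..\<beta>}" if "0 < \<delta>" "\<delta> < \<beta>" for \<delta>
    using integrable_linear[OF assms(2)[OF that] bounded_linear_inner_left] by (simp add: o_def)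
  then show "L1 \<bullet> b = L2 \<bullet> b"
    using has_Z_integral_unique_real[OF assms(1) _ assms(3,4)]
      has_Z_integral_inner[OF assms(1,2)] assms(3-6) by blast
qed

end
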